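(* Let $k$ and $l$ be integers with $2 \leq k \leq l$ and let $\gamma > 0$ be a real number. Let $S_{\mathbb{R}}(\gamma,k,l)$ denote the smallest real number $S$ such that for every coloring of the real numbers in the closed interval $[\gamma,S]$ with the two colors red and blue, there is a red solution to $x_1 + x_2 + \cdots + x_k = x_0$ or a blue solution to $x_1 + x_2 + \cdots + x_l = x_0$. Then $S_{\mathbb{R}}(\gamma,k,l) = \gamma kl + \gamma k - \gamma$.
   Context: A red (resp. blue) solution to an equation means real numbers $x_0, x_1, \dots$ in the colored interval satisfying the equation, all colored red (resp. blue); the variables need not be distinct. *)

theory Defs
  imports Complex_Main
begin

datatype color = Red | Blue

text \<open>The values of \<open>c\<close> outside \<open>I\<close> are irrelevant, so a total function \<open>c\<close> represents a
  coloring of \<open>I\<close>.\<close>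

definition mono_solution :: "(real \<Rightarrow> color) \<Rightarrow> real set \<Rightarrow> color \<Rightarrow> nat \<Rightarrow> (nat \<Rightarrow> real) \<Rightarrow> bool" where
  "mono_solution c I col m x \<longleftrightarrow>
     (\<forall>i\<le>m. x i \<in> I \<and> c (x i) = col) \<and> (\<Sum>i=1..m. x i) = x 0"

definition forces_solution :: "real \<Rightarrow> nat \<Rightarrow> nat \<Rightarrow> real \<Rightarrow> bool" where
  "forces_solution \<gamma> k l S \<longleftrightarrow>
     (\<forall>c. (\<exists>x. mono_solution c {\<gamma>..S} Red k x) \<or> (\<exists>x. mono_solution c {\<gamma>..S} Blue l x))"

text \<open>Not every set of reals has a least element, so this value is only meaningful once a
  least element is known to exist.\<close>

definition S_real :: "real \<Rightarrow> nat \<Rightarrow> nat \<Rightarrow> real" where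
  "S_real \<gamma> k l = (LEAST S. forces_solution \<gamma> k l S)"

end

theory Submission
  imports Defs
begin

text \<open>
  Measure everything in units of \<open>\<gamma>\<close> and put \<open>N = k l + k - 1\<close>. If \<open>S < N\<close>, color
  \<open>[k, k l)\<close> blue and everything else red: \<open>k\<close> reds below \<open>k\<close> sum into \<open>[k, k\<^sup>2)\<close>, which
  is blue, one red at least \<open>k l\<close> pushes the sum to \<open>N\<close> or beyond, and \<open>l\<close> blues sum to at
  least \<open>k l\<close>.

  Conversely, consider a coloring of \<open>[1, N]\<close> without solutions.

  If \<open>1\<close> is red, then \<open>k\<close> is blue, \<open>k l\<close> is red and \<open>N\<close> is blue. For \<open>k = l\<close> the
  number \<open>k + 1\<close> has no admissible color, as \<open>1 + (k - 1)(k + 1) = k l\<close> and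
  \<open>k + (k - 1)(k + 1) = N\<close>. For \<open>k < l\<close>, \<open>l\<close> is blue, and with
  \<open>w = 1 + (k - 1)/(l - k)\<close> the identity \<open>(l - k) w + (k - 1) l + k = N\<close> makes \<open>w\<close> red, so
  \<open>z = w + (k - 1)\<close> is blue, contradicting \<open>(l - k) z + k k = N\<close>.

  If \<open>1\<close> is blue, then \<open>l\<close> is red, \<open>k l\<close> is blue and \<open>k\<close> is red. If \<open>N\<close> were red,
  \<open>l + (k - 1)(l + 1) = N\<close> would make \<open>l + 1\<close> blue, contradicting
  \<open>(k - 1)(l + 1) + (l - k + 1) = k l\<close>. So \<open>N\<close> is blue, whence \<open>N - (l - 1) = (k - 1) l + k\<close>
  is red, a red solution.
\<close>

lemma color_not_Red_iff: "c \<noteq> Red \<longleftrightarrow> c = Blue"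
  by (cases c) auto

text \<open>Every solution needed below has at most three distinct summands, so multiplicities
  \<open>p\<close>, \<open>q\<close>, \<open>r\<close> describe it. A slot of multiplicity 0 still
  needs a value of the right color, hence the padding arguments in later uses.\<close>

lemma mono_solution_three_values:
  fixes a b e d :: real
  assumes "a \<in> I" "b \<in> I" "e \<in> I" "d \<in> I"
    and "c a = col" "c b = col" "c e = col" "c d = col"
    and m: "p + q + r = m" and eq: "real p * a + real q * b + real r * e = d"
  shows "\<exists>x. mono_solution c I col m x"
proof -
  define x where "x i = (if i = 0 then d else if i \<le> p then a else if i \<le> p + q then b else e)"
    for i :: nat
  have "(\<Sum>i=1..m. x i) = (\<Sum>i=1..p. x i) + (\<Sum>i=p+1..p+q. x i) + (\<Sum>i=p+q+1..p+q+r. x i)"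
    using sum.ub_add_nat[of 1 p x q] sum.ub_add_nat[of 1 "p + q" x r] m by simp
  also have "(\<Sum>i=1..p. x i) = (\<Sum>i=1..p. a)"
    by (rule sum.cong) (auto simp: x_def)
  also have "(\<Sum>i=p+1..p+q. x i) = (\<Sum>i=p+1..p+q. b)"
    by (rule sum.cong) (auto simp: x_def)
  also have "(\<Sum>i=p+q+1..p+q+r. x i) = (\<Sum>i=p+q+1..p+q+r. e)"
    by (rule sum.cong) (auto simp: x_def)
  finally have "(\<Sum>i=1..m. x i) = x 0"
    using eq by (simp add: x_def)
  then have "mono_solution c I col m x"
    unfolding mono_solution_def using assms by (auto simp: x_def)
  then show ?thesis by blast
qed

lemma forces_solution_upper:
  fixes k l :: nat and \<gamma> :: real
  assumes k2: "2 \<le> k" and kl: "k \<le> l" and g: "\<gamma> > 0"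
  shows "forces_solution \<gamma> k l (\<gamma> * real k * real l + \<gamma> * real k - \<gamma>)"
proof -
  define K L where "K = real k" and "L = real l"
  define N where "N = K * L + K - 1"
  have K2: "2 \<le> K" and KL: "K \<le> L"
    using k2 kl by (auto simp: K_def L_def)
  have "2 * L \<le> K * L" "K * 1 \<le> K * L"
    using K2 KL by (intro mult_right_mono mult_left_mono; simp)+
  then have LKL: "2 * L \<le> K * L" and KKL: "K \<le> K * L" by simp_all
  have N_eq: "\<gamma> * real k * real l + \<gamma> * real k - \<gamma> = \<gamma> * N"
    by (simp add: N_def K_def L_def algebra_simps)
  have False if no_red: "\<nexists>x. mono_solution c {\<gamma>..\<gamma> * N} Red k x"
    and no_blue: "\<nexists>x. mono_solution c {\<gamma>..\<gamma> * N} Blue l x" for c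
  proof -
    \<comment> \<open>Rescaling by \<open>\<gamma>\<close> moves the coloring to
      \<open>[1, N]\<close>.\<close>
    define C where "C t = c (\<gamma> * t)" for t
    have I: "\<gamma> * t \<in> {\<gamma>..\<gamma> * N}" if "1 \<le> t" "t \<le> N" for t
      using g that by simp
    have sol: "\<exists>x. mono_solution c {\<gamma>..\<gamma> * N} col m x"
      if "1 \<le> a" "a \<le> N" "1 \<le> b" "b \<le> N" "1 \<le> e" "e \<le> N" "1 \<le> d" "d \<le> N"
        and "C a = col" "C b = col" "C e = col" "C d = col"
        and "p + q + r = m" and eq: "real p * a + real q * b + real r * e = d"
      for a b e d col p q r m
    proof (rule mono_solution_three_values[where a = "\<gamma> * a" and b = "\<gamma> * b" and e = "\<gamma> * e"
          and d = "\<gamma> * d" and p = p and q = q and r = r])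
      show "real p * (\<gamma> * a) + real q * (\<gamma> * b) + real r * (\<gamma> * e) = \<gamma> * d"
        unfolding eq[symmetric] by (simp add: algebra_simps)
    qed (use that I in \<open>auto simp: C_def\<close>)
    have red: False
      if "C a = Red" "C b = Red" "C e = Red" "C d = Red" "p + q + r = k"
        "real p * a + real q * b + real r * e = d"
        "1 \<le> a" "a \<le> N" "1 \<le> b" "b \<le> N" "1 \<le> e" "e \<le> N" "1 \<le> d" "d \<le> N"
      for a b e d p q r
      using sol[of a b e d Red p q r k] that no_red by blast
    \<comment> \<open>Stated with \<open>\<noteq> Red\<close>, the form in which case splits and
      refutations by \<open>red\<close> deliver blueness.\<close>
    have blue: False
      if "C a \<noteq> Red" "C b \<noteq> Red" "C e \<noteq> Red" "C d \<noteq> Red" "p + q + r = l"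
        "real p * a + real q * b + real r * e = d"
        "1 \<le> a" "a \<le> N" "1 \<le> b" "b \<le> N" "1 \<le> e" "e \<le> N" "1 \<le> d" "d \<le> N"
      for a b e d p q r
      using sol[of a b e d Blue p q r l] that no_blue unfolding color_not_Red_iff by blast
    have bounds: "1 \<le> N" "1 \<le> K" "K \<le> N" "1 \<le> L" "L \<le> N" "1 \<le> K * L" "K * L \<le> N"
      "1 \<le> K + 1" "K + 1 \<le> N" "1 \<le> L + 1" "L + 1 \<le> N"
      "1 \<le> K * L + K - L" "K * L + K - L \<le> N"
      using K2 KL LKL KKL unfolding N_def by linarith+
    have km1: "real (k - 1) = K - 1" and lm1: "real (l - 1) = L - 1"
      and lmk: "real (l - k) = L - K"
      using k2 kl by (auto simp: K_def L_def of_nat_diff)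
    show False
    proof (cases "C 1 = Red")
      case True
      have k_blue: "C K \<noteq> Red"
        using red[of 1 1 1 K k 0 0] True bounds by (auto simp: K_def)
      have kl_red: "C (K * L) = Red"
        using blue[of K K K "K * L" l 0 0] k_blue bounds by (auto simp: L_def)
      have N_blue: "C N \<noteq> Red"
        using red[of "K * L" 1 1 N 1 "k - 1" 0] kl_red True bounds k2 km1
        by (auto simp: N_def)
      show False
      proof (cases "k = l")
        case True
        then have "L = K" by (simp add: K_def L_def)
        show False
        proof (cases "C (K + 1) = Red")
          case True
          show False
            using red[of "K + 1" 1 1 "K * L" "k - 1" 1 0] True \<open>C 1 = Red\<close> kl_red bounds k2 km1
              \<open>L = K\<close> by (auto simp: algebra_simps)
        next
          case False
          show False
            using blue[of "K + 1" K K N "k - 1" 1 0] False k_blue N_blue bounds k2 km1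
              \<open>L = K\<close> \<open>k = l\<close> by (auto simp: N_def algebra_simps)
        qed
      next
        case False
        then have LK1: "1 \<le> L - K" using kl by (simp add: K_def L_def)
        have l_blue: "C L \<noteq> Red"
          using red[of L L L "K * L" k 0 0] kl_red bounds by (auto simp: K_def)
        \<comment> \<open>Chosen so that \<open>l - k\<close> copies of \<open>w\<close> sum to
          \<open>L - 1\<close>, the gap between \<open>(K - 1) * L + K\<close> and \<open>N\<close>.
          It need not be an integer.\<close>
        define w where "w = 1 + (K - 1) / (L - K)"
        have w_mult: "(L - K) * w = L - 1"
          using LK1 by (simp add: w_def field_simps)
        \<comment> \<open>Distinct integers differ by at least 1, so \<open>w\<close> is at most
          \<open>K\<close>; this keeps \<open>w\<close> and \<open>w + (K - 1)\<close> inside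
          \<open>[1, N]\<close>.\<close>
        have quot: "0 \<le> (K - 1) / (L - K)" "(K - 1) / (L - K) \<le> K - 1"
        proof -
          show "0 \<le> (K - 1) / (L - K)" using K2 LK1 by simp
          have "(K - 1) * 1 \<le> (K - 1) * (L - K)"
            using K2 LK1 by (intro mult_left_mono) auto
          then show "(K - 1) / (L - K) \<le> K - 1"
            using LK1 by (simp add: divide_le_eq)
        qed
        have w_bounds: "1 \<le> w" "w \<le> N" "1 \<le> w + (K - 1)" "w + (K - 1) \<le> N"
          using quot K2 KL LKL unfolding w_def N_def by linarith+
        have w_red: "C w = Red"
        proof (rule ccontr)
          assume "C w \<noteq> Red"
          moreover have "(L - K) * w + (K - 1) * L + K = N"
            unfolding w_mult N_def by (simp add: algebra_simps)
          ultimately show False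
            using blue[of w L K N "l - k" "k - 1" 1] l_blue k_blue N_blue bounds w_bounds
              k2 kl km1 lmk by auto
        qed
        have z_blue: "C (w + (K - 1)) \<noteq> Red"
          using red[of w 1 1 "w + (K - 1)" 1 "k - 1" 0] w_red True bounds w_bounds k2 km1 by auto
        have "(L - K) * (w + (K - 1)) + K * K = N"
          unfolding distrib_left w_mult N_def by (simp add: algebra_simps)
        then show False
          using blue[of "w + (K - 1)" K K N "l - k" k 0] z_blue k_blue N_blue bounds w_bounds
            kl lmk by (auto simp: K_def)
      qed
    next
      case False
      have l_red: "C L = Red"
        using blue[of 1 1 1 L l 0 0] False bounds by (auto simp: L_def)
      have kl_blue: "C (K * L) \<noteq> Red"
        using red[of L L L "K * L" k 0 0] l_red bounds by (auto simp: K_def)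
      have k_red: "C K = Red"
        using blue[of K K K "K * L" l 0 0] kl_blue bounds by (auto simp: L_def)
      have N_blue: "C N \<noteq> Red"
      proof
        assume N_red: "C N = Red"
        have l1_blue: "C (L + 1) \<noteq> Red"
          using red[of L "L + 1" "L + 1" N 1 "k - 1" 0] l_red N_red bounds k2 km1
          by (auto simp: N_def algebra_simps)
        have "real (l - (k - 1)) = L - K + 1"
          using k2 kl by (simp add: K_def L_def of_nat_diff)
        then show False
          using blue[of "L + 1" 1 1 "K * L" "k - 1" "l - (k - 1)" 0] l1_blue False kl_blue
            bounds k2 kl km1 by (auto simp: algebra_simps)
      qed
      have "C (K * L + K - L) = Red"
        using blue[of "K * L + K - L" 1 1 N 1 "l - 1" 0] False N_blue bounds k2 kl lm1
        by (auto simp: N_def)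
      then show False
        using red[of L K K "K * L + K - L" "k - 1" 1 0] l_red k_red bounds k2 km1
        by (auto simp: algebra_simps)
    qed
  qed
  then show ?thesis
    unfolding forces_solution_def N_eq by blast
qed

lemma forces_solution_lower:
  fixes k l :: nat and \<gamma> S :: real
  assumes k2: "2 \<le> k" and kl: "k \<le> l" and g: "\<gamma> > 0"
    and forces: "forces_solution \<gamma> k l S"
  shows "\<gamma> * real k * real l + \<gamma> * real k - \<gamma> \<le> S"
proof (rule ccontr)
  assume "\<not> ?thesis"
  then have S: "S < \<gamma> * real k * real l + \<gamma> * real k - \<gamma>" by simp
  \<comment> \<open>The block is half-open: its left end is the sum of \<open>k\<close> copies of
    the red \<open>\<gamma>\<close>, its right end the sum of \<open>l\<close> copies of the blue
    left end.\<close>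
  define c where "c t = (if \<gamma> * real k \<le> t \<and> t < \<gamma> * real k * real l then Blue else Red)" for t
  consider (red) x where "mono_solution c {\<gamma>..S} Red k x"
    | (blue) x where "mono_solution c {\<gamma>..S} Blue l x"
    using forces unfolding forces_solution_def by blast
  then show False
  proof cases
    case red
    then have x: "\<gamma> \<le> x i" "x i \<le> S" "c (x i) = Red" if "i \<le> k" for i
      using that by (auto simp: mono_solution_def)
    have sum: "(\<Sum>i=1..k. x i) = x 0"
      using red by (simp add: mono_solution_def)
    have "(\<Sum>i=1..k. \<gamma>) \<le> (\<Sum>i=1..k. x i)"
      by (rule sum_mono) (use x in auto)
    then have "\<gamma> * real k \<le> x 0"
      using sum by (simp add: mult.commute)
    \<comment> \<open>A red value not below the blue block lies beyond it.\<close>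
    then have big: "\<gamma> * real k * real l \<le> x 0"
      using x(3)[of 0] by (auto simp: c_def split: if_splits)
    show False
    proof (cases "\<exists>j\<in>{1..k}. \<gamma> * real k * real l \<le> x j")
      case True
      then obtain j where j: "j \<in> {1..k}" "\<gamma> * real k * real l \<le> x j" by blast
      have "(\<Sum>i\<in>{1..k} - {j}. \<gamma>) \<le> (\<Sum>i\<in>{1..k} - {j}. x i)"
        by (rule sum_mono) (use x in auto)
      then have "\<gamma> * (real k - 1) \<le> (\<Sum>i\<in>{1..k} - {j}. x i)"
        using j(1) k2 by (simp add: of_nat_diff mult.commute)
      moreover have "x 0 = x j + (\<Sum>i\<in>{1..k} - {j}. x i)"
        using sum j(1) by (simp add: sum.remove)
      ultimately show False
        using j(2) S x(2)[of 0] by (simp add: algebra_simps)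
    next
      case False
      have "x i < \<gamma> * real k" if "i \<in> {1..k}" for i
        using that False x(3)[of i] by (force simp: c_def split: if_splits)
      then have "(\<Sum>i=1..k. x i) < (\<Sum>i=1..k. \<gamma> * real k)"
        using k2 by (intro sum_strict_mono) auto
      also have "\<dots> = \<gamma> * real k * real k"
        by simp
      also have "\<dots> \<le> \<gamma> * real k * real l"
        using g kl by (intro mult_left_mono) auto
      finally show False
        using sum big by simp
    qed
  next
    case blue
    then have x: "\<gamma> * real k \<le> x i" "x i < \<gamma> * real k * real l" if "i \<le> l" for i
      using that by (auto simp: mono_solution_def c_def split: if_splits)
    have "(\<Sum>i=1..l. \<gamma> * real k) \<le> (\<Sum>i=1..l. x i)"
      by (rule sum_mono) (use x in auto)
    also have "\<dots> = x 0"
      using blue by (simp add: mono_solution_def)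
    finally show False
      using x(2)[of 0] by (simp add: algebra_simps)
  qed
qed

theorem theorem3:
  fixes k l :: nat and \<gamma> :: real
  assumes "2 \<le> k" and "k \<le> l" and "\<gamma> > 0"
  shows "forces_solution \<gamma> k l (S_real \<gamma> k l)
    \<and> (\<forall>S. forces_solution \<gamma> k l S \<longrightarrow> S_real \<gamma> k l \<le> S)
    \<and> S_real \<gamma> k l = \<gamma> * real k * real l + \<gamma> * real k - \<gamma>"
proof -
  \<comment> \<open>The upper bound lemma shows that the minimum is attained, so
    \<open>LEAST\<close> is meaningful here.\<close>
  have "S_real \<gamma> k l = \<gamma> * real k * real l + \<gamma> * real k - \<gamma>"
    unfolding S_real_def
    by (rule Least_equality) (use assms forces_solution_upper forces_solution_lower in auto)
  then show ?thesis
    using assms forces_solution_upper forces_solution_lower by auto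
qed

end
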